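(* Let $n\ge 4$ be even and let $W_n = K_1\vee C_n$ be the wheel graph. Then there are exactly $2^{\frac{n}{2}+1}-1$ switching classes of signatures of $W_n$ that maximise the frustration index (i.e. with $l(W_n,\sigma)=l_{\max}(W_n)$).
   Context: All graphs are finite, simple and undirected. A signed graph $\Sigma=(G,\sigma)$ is a graph $G$ with a signature $\sigma:E(G)\to\{+1,-1\}$. The sign of a cycle is the product of the signs of its edges; $\Sigma$ is balanced if all its cycles are positive. The frustration index $l(\Sigma)$ is the minimum number of edges whose deletion makes $\Sigma$ balanced; it is invariant under switching. $l_{\max}(G)=\max_\sigma l(G,\sigma)$. Switching $\Sigma$ at a vertex subset $X$ negates the signs of all edges with exactly one endpoint in $X$; a switching class is an equivalence class of signatures of the (labelled) graph $G$ under switching. $C_n$ is the cycle on $n$ vertices and $\vee$ denotes the join of vertex-disjoint graphs. *)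

theory Defs
  imports Main "HOL-Library.FuncSet"
begin

record 'a graph =
  verts :: "'a set"
  edges :: "'a set set"

definition simple_graph :: "'a graph \<Rightarrow> bool" where
  "simple_graph G \<longleftrightarrow> finite (verts G) \<and> (\<forall>e\<in>edges G. e \<subseteq> verts G \<and> card e = 2)"

definition delete_edges :: "'a graph \<Rightarrow> 'a set set \<Rightarrow> 'a graph" where
  "delete_edges G F = \<lparr>verts = verts G, edges = edges G - F\<rparr>"

definition complete_graph :: "nat \<Rightarrow> nat graph" where
  "complete_graph n = \<lparr>verts = {..<n}, edges = {e. e \<subseteq> {..<n} \<and> card e = 2}\<rparr>"

text \<open>Meaningful (a simple graph) only for \<open>n \<ge> 3\<close>.\<close>

definition cycle_graph :: "nat \<Rightarrow> nat graph" where
  "cycle_graph n = \<lparr>verts = {..<n}, edges = {{i, (i + 1) mod n} |i. i < n}\<rparr>"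

text \<open>The sum type makes the two vertex sets disjoint.\<close>

definition join :: "'a graph \<Rightarrow> 'b graph \<Rightarrow> ('a + 'b) graph" where
  "join G H = \<lparr>verts = verts G <+> verts H,
     edges = (image Inl) ` edges G \<union> (image Inr) ` edges H
       \<union> {{Inl u, Inr v} |u v. u \<in> verts G \<and> v \<in> verts H}\<rparr>"

definition wheel_graph :: "nat \<Rightarrow> (nat + nat) graph" where
  "wheel_graph n = join (complete_graph 1) (cycle_graph n)"

text \<open>A cycle is given by the cyclic list of its vertices.\<close>

definition cycle_edges :: "'a list \<Rightarrow> 'a set set" where
  "cycle_edges vs = {{vs ! i, vs ! ((i + 1) mod length vs)} |i. i < length vs}"

definition is_cycle :: "'a graph \<Rightarrow> 'a list \<Rightarrow> bool" where
  "is_cycle G vs \<longleftrightarrow> 3 \<le> length vs \<and> distinct vs \<and> set vs \<subseteq> verts G \<and> cycle_edges vs \<subseteq> edges G"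

text \<open>Signatures are extensional (undefined off the edge set), so that distinct elements of
  \<open>signatures G\<close> differ on some edge of \<open>G\<close> and counting them is meaningful.\<close>

definition signatures :: "'a graph \<Rightarrow> ('a set \<Rightarrow> int) set" where
  "signatures G = edges G \<rightarrow>\<^sub>E {1, -1}"

definition cycle_sign :: "('a set \<Rightarrow> int) \<Rightarrow> 'a list \<Rightarrow> int" where
  "cycle_sign \<sigma> vs = (\<Prod>e\<in>cycle_edges vs. \<sigma> e)"

definition balanced :: "'a graph \<Rightarrow> ('a set \<Rightarrow> int) \<Rightarrow> bool" where
  "balanced G \<sigma> \<longleftrightarrow> (\<forall>vs. is_cycle G vs \<longrightarrow> cycle_sign \<sigma> vs = 1)"

definition frustration_index :: "'a graph \<Rightarrow> ('a set \<Rightarrow> int) \<Rightarrow> nat" where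
  "frustration_index G \<sigma> =
     Min {card F |F. F \<subseteq> edges G \<and> balanced (delete_edges G F) (restrict \<sigma> (edges G - F))}"

definition max_frustration_index :: "'a graph \<Rightarrow> nat" where
  "max_frustration_index G = Max {frustration_index G \<sigma> |\<sigma>. \<sigma> \<in> signatures G}"

definition switch :: "'a graph \<Rightarrow> 'a set \<Rightarrow> ('a set \<Rightarrow> int) \<Rightarrow> ('a set \<Rightarrow> int)" where
  "switch G X \<sigma> = (\<lambda>e\<in>edges G. if card (e \<inter> X) = 1 then - \<sigma> e else \<sigma> e)"

definition switching_rel :: "'a graph \<Rightarrow> (('a set \<Rightarrow> int) \<times> ('a set \<Rightarrow> int)) set" where
  "switching_rel G =
     {(\<sigma>, \<tau>). \<sigma> \<in> signatures G \<and> \<tau> \<in> signatures G \<and> (\<exists>X\<subseteq>verts G. \<tau> = switch G X \<sigma>)}"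

definition switching_classes :: "'a graph \<Rightarrow> ('a set \<Rightarrow> int) set set" where
  "switching_classes G = signatures G // switching_rel G"

lemma simple_graph_wheel_graph:
  assumes "3 \<le> n"
  shows "simple_graph (wheel_graph n)"
proof -
  have 1: "finite (verts (wheel_graph n))"
    by (auto simp: wheel_graph_def join_def complete_graph_def cycle_graph_def)
  have ne: "i \<noteq> Suc i mod n" if "i < n" for i
    using that assms by (auto simp: mod_Suc split: if_splits)
  have 2: "e \<subseteq> verts (wheel_graph n) \<and> card e = 2" if "e \<in> edges (wheel_graph n)" for e
  proof -
    from that consider d where "e = Inl ` d" "d \<subseteq> {..<1}" "card d = 2"
      | i where "e = {Inr i, Inr (Suc i mod n)}" "i < n"
      | v where "e = {Inl 0, Inr v}" "v < n"
      by (auto simp: wheel_graph_def join_def complete_graph_def cycle_graph_def)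
    then show ?thesis
    proof cases
      case 1
      then show ?thesis using card_mono[of "{..<1::nat}" d] by simp
    next
      case (2 i)
      then show ?thesis using ne[of i] assms
        by (auto simp: wheel_graph_def join_def complete_graph_def cycle_graph_def)
    next
      case 3
      then show ?thesis
        by (auto simp: wheel_graph_def join_def complete_graph_def cycle_graph_def)
    qed
  qed
  from 1 2 show ?thesis by (simp add: simple_graph_def)
qed

lemma equiv_switching_rel:
  assumes "simple_graph G"
  shows "equiv (signatures G) (switching_rel G)"
proof -
  have sw0: "switch G {} \<sigma> = \<sigma>" if "\<sigma> \<in> signatures G" for \<sigma>
    using that by (fastforce simp: switch_def signatures_def PiE_def extensional_def)
  have parity: "(card (e \<inter> ((X - Y) \<union> (Y - X))) = 1) = ((card (e \<inter> X) = 1) \<noteq> (card (e \<inter> Y) = 1))"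
    if e: "e \<in> edges G" for e X Y
  proof -
    from e assms have "card e = 2" by (simp add: simple_graph_def)
    then obtain a b where ab: "e = {a, b}" "a \<noteq> b" by (auto simp: card_2_iff)
    have c: "card (e \<inter> Z) = 1 \<longleftrightarrow> (a \<in> Z) \<noteq> (b \<in> Z)" for Z
      using ab by (cases "a \<in> Z"; cases "b \<in> Z") (auto simp: Int_insert_left)
    show ?thesis unfolding c by auto
  qed
  have sw2: "switch G Y (switch G X \<sigma>) = switch G ((X - Y) \<union> (Y - X)) \<sigma>" for X Y \<sigma>
    using parity by (auto simp: switch_def fun_eq_iff)
  show ?thesis
  proof (rule equivI)
    show "switching_rel G \<subseteq> signatures G \<times> signatures G"
      by (auto simp: switching_rel_def)
    show "refl_on (signatures G) (switching_rel G)"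
      by (rule refl_onI) (use sw0 in \<open>force simp: switching_rel_def\<close>)
    show "sym (switching_rel G)"
    proof (rule symI)
      fix \<sigma> \<tau> assume "(\<sigma>, \<tau>) \<in> switching_rel G"
      then obtain X where X: "X \<subseteq> verts G" "\<tau> = switch G X \<sigma>"
        and s: "\<sigma> \<in> signatures G" "\<tau> \<in> signatures G"
        by (auto simp: switching_rel_def)
      have "switch G X \<tau> = \<sigma>" using X(2) sw2[of X X \<sigma>] sw0[OF s(1)] by simp
      with X(1) s show "(\<tau>, \<sigma>) \<in> switching_rel G" by (auto simp: switching_rel_def)
    qed
    show "trans (switching_rel G)"
    proof (rule transI)
      fix \<sigma> \<tau> \<rho> assume "(\<sigma>, \<tau>) \<in> switching_rel G" "(\<tau>, \<rho>) \<in> switching_rel G"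
      then obtain X Y where "X \<subseteq> verts G" "\<tau> = switch G X \<sigma>" "Y \<subseteq> verts G" "\<rho> = switch G Y \<tau>"
        and s: "\<sigma> \<in> signatures G" "\<rho> \<in> signatures G"
        by (auto simp: switching_rel_def)
      then have "\<rho> = switch G ((X - Y) \<union> (Y - X)) \<sigma>" "(X - Y) \<union> (Y - X) \<subseteq> verts G"
        using sw2[of Y X \<sigma>] by auto
      with s show "(\<sigma>, \<rho>) \<in> switching_rel G" unfolding switching_rel_def by blast
    qed
  qed
qed

end

theory Submission
  imports Defs
begin

text \<open>A switching class of the wheel is determined by its set of positive triangles (hub plus one
  rim edge), and every set of triangles occurs. Triangles of one parity are edge-disjoint, so if
  all positive triangles have the same parity, the \<open>n / 2\<close> triangles of the other
  parity force frustration index at least \<open>n / 2\<close>. Conversely, let \<open>A\<close> be an independent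
  set of rim vertices meeting the rim edge of every negative triangle; deleting one edge near each
  vertex of \<open>A\<close> leaves a balanced graph. Such an \<open>A\<close> always exists with \<open>n / 2\<close> elements, and
  if two positive triangles have different parity, the rim edges on the two
  arcs between them can be paired up, which gives \<open>A\<close> with \<open>n / 2 - 1\<close> elements.\<close>

section \<open>Balance and the frustration index\<close>

lemma Suc_mod_eq: "i < n \<Longrightarrow> Suc i mod n = (if Suc i = n then 0 else Suc i)"
  by auto

lemma bij_betw_Suc_mod: "bij_betw (\<lambda>i. Suc i mod n) {..<n} {..<n}"
proof -
  have "inj_on (\<lambda>i. Suc i mod n) {..<n}"
    by (auto simp: inj_on_def Suc_mod_eq split: if_splits)
  moreover have "(\<lambda>i. Suc i mod n) ` {..<n} \<subseteq> {..<n}"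
    by auto
  ultimately show ?thesis
    by (simp add: bij_betw_def endo_inj_surj)
qed

text \<open>For \<open>n = 2\<close> the pairs \<open>{0, 1}\<close> and \<open>{1, 0}\<close> would
  coincide, hence \<open>3 \<le> n\<close>.\<close>

lemma cyclic_edge_eq_iff:
  assumes "3 \<le> n" "i < n" "j < n"
  shows "{i, Suc i mod n} = {j, Suc j mod n} \<longleftrightarrow> i = j"
  using assms by (auto simp: doubleton_eq_iff Suc_mod_eq split: if_splits)

text \<open>Allows the product over the set \<open>cycle_edges vs\<close> in
  \<open>cycle_sign\<close> to be taken over positions of \<open>vs\<close>. Positions determine
  vertices injectively, so the claim reduces to edges between indices.\<close>

lemma inj_on_cycle_edge:
  assumes "3 \<le> length vs" "distinct vs"
  shows "inj_on (\<lambda>i. {vs ! i, vs ! (Suc i mod length vs)}) {..<length vs}"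
proof (rule inj_onI)
  let ?m = "length vs"
  fix i j assume ij: "i \<in> {..<?m}" "j \<in> {..<?m}"
    and eq: "{vs ! i, vs ! (Suc i mod ?m)} = {vs ! j, vs ! (Suc j mod ?m)}"
  have "(!) vs ` {i, Suc i mod ?m} = (!) vs ` {j, Suc j mod ?m}"
    using eq by simp
  moreover have "inj_on ((!) vs) {..<?m}"
    using assms(2) by (simp add: inj_on_nth)
  moreover have "{i, Suc i mod ?m} \<subseteq> {..<?m}" "{j, Suc j mod ?m} \<subseteq> {..<?m}"
    using ij mod_less_divisor[OF order_less_le_trans[OF _ assms(1)]] by auto
  ultimately have "{i, Suc i mod ?m} = {j, Suc j mod ?m}"
    using inj_on_image_eq_iff by metis
  then show "i = j"
    using cyclic_edge_eq_iff assms(1) ij by simp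
qed

lemma cycle_edges_triangle: "cycle_edges [a, b, c] = {{a, b}, {b, c}, {a, c}}"
proof -
  have "i < 3 \<longleftrightarrow> i = 0 \<or> i = 1 \<or> i = 2" for i :: nat
    by linarith
  then have "{i. i < (3::nat)} = {0, 1, 2}"
    by blast
  moreover have "length [a, b, c] = 3"
    by simp
  ultimately have "cycle_edges [a, b, c] =
      (\<lambda>i. {[a, b, c] ! i, [a, b, c] ! ((i + 1) mod 3)}) ` {0, 1, 2}"
    unfolding cycle_edges_def setcompr_eq_image by metis
  then show ?thesis
    by (simp add: insert_commute)
qed

text \<open>A potential \<open>s\<close> with values 1 and -1 certifies balance: around a cycle
  every vertex contributes \<open>s\<close> twice, once for each incident cycle edge, and the
  squares are 1.\<close>

lemma balancedI:
  fixes s :: "'a \<Rightarrow> int"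
  assumes s: "\<And>u. s u * s u = 1"
    and \<sigma>: "\<And>u v. {u, v} \<in> edges G \<Longrightarrow> \<sigma> {u, v} = s u * s v"
  shows "balanced G \<sigma>"
  unfolding balanced_def
proof (intro allI impI)
  fix vs assume cyc: "is_cycle G vs"
  let ?m = "length vs"
  let ?e = "\<lambda>i. {vs ! i, vs ! (Suc i mod ?m)}"
  have m: "3 \<le> ?m" "distinct vs" and sub: "cycle_edges vs \<subseteq> edges G"
    using cyc by (auto simp: is_cycle_def)
  have ce: "cycle_edges vs = ?e ` {..<?m}"
    by (auto simp: cycle_edges_def)
  have "cycle_sign \<sigma> vs = (\<Prod>i<?m. \<sigma> (?e i))"
    unfolding cycle_sign_def ce by (rule prod.reindex_cong[OF inj_on_cycle_edge[OF m]]) auto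
  also have "\<dots> = (\<Prod>i<?m. s (vs ! i) * s (vs ! (Suc i mod ?m)))"
    using sub ce by (intro prod.cong refl \<sigma>) auto
  also have "\<dots> = (\<Prod>i<?m. s (vs ! i)) * (\<Prod>i<?m. s (vs ! (Suc i mod ?m)))"
    by (rule prod.distrib)
  also have "(\<Prod>i<?m. s (vs ! (Suc i mod ?m))) = (\<Prod>i<?m. s (vs ! i))"
    by (rule prod.reindex_bij_betw[OF bij_betw_Suc_mod, where g = "\<lambda>i. s (vs ! i)"])
  also have "(\<Prod>i<?m. s (vs ! i)) * (\<Prod>i<?m. s (vs ! i)) = (\<Prod>i<?m. s (vs ! i) * s (vs ! i))"
    by (rule prod.distrib[symmetric])
  also have "\<dots> = 1"
    by (simp add: s)
  finally show "cycle_sign \<sigma> vs = 1" .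
qed

lemma balanced_no_edges: "edges G = {} \<Longrightarrow> balanced G \<sigma>"
  by (rule balancedI[where s = "\<lambda>_. 1"]) auto

lemma finite_frustration_set:
  assumes "finite (edges G)"
  shows "finite {card F |F. F \<subseteq> edges G \<and> P F}"
  by (rule finite_subset[of _ "card ` Pow (edges G)"]) (use assms in auto)

lemma frustration_index_le:
  assumes "finite (edges G)" "F \<subseteq> edges G"
    and "balanced (delete_edges G F) (restrict \<sigma> (edges G - F))"
  shows "frustration_index G \<sigma> \<le> card F"
  unfolding frustration_index_def
  by (rule Min_le[OF finite_frustration_set[OF assms(1)]]) (use assms in auto)

lemma frustration_index_ge:
  assumes "finite (edges G)"
    and "\<And>F. F \<subseteq> edges G \<Longrightarrow> balanced (delete_edges G F) (restrict \<sigma> (edges G - F)) \<Longrightarrow> c \<le> card F"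
  shows "c \<le> frustration_index G \<sigma>"
  unfolding frustration_index_def
proof (rule Min.boundedI[OF finite_frustration_set[OF assms(1)]])
  \<comment> \<open>Deleting every edge is always admissible, so the minimum is over a nonempty
    set.\<close>
  have "balanced (delete_edges G (edges G)) (restrict \<sigma> (edges G - edges G))"
    by (rule balanced_no_edges) (simp add: delete_edges_def)
  then show "{card F |F. F \<subseteq> edges G \<and> balanced (delete_edges G F) (restrict \<sigma> (edges G - F))} \<noteq> {}"
    by blast
qed (use assms(2) in auto)

section \<open>Spokes, rim edges and triangles of the wheel\<close>

definition spoke :: "nat \<Rightarrow> (nat + nat) set" where
  "spoke i = {Inl 0, Inr i}"

definition rim :: "nat \<Rightarrow> nat \<Rightarrow> (nat + nat) set" where
  "rim n i = {Inr i, Inr (Suc i mod n)}"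

definition triangle_sign :: "nat \<Rightarrow> ((nat + nat) set \<Rightarrow> int) \<Rightarrow> nat \<Rightarrow> int" where
  "triangle_sign n \<sigma> i = \<sigma> (spoke i) * \<sigma> (spoke (Suc i mod n)) * \<sigma> (rim n i)"

definition positive_triangles :: "nat \<Rightarrow> ((nat + nat) set \<Rightarrow> int) \<Rightarrow> nat set" where
  "positive_triangles n \<sigma> = {i. i < n \<and> triangle_sign n \<sigma> i = 1}"

lemma verts_wheel: "verts (wheel_graph n) = insert (Inl 0) (Inr ` {..<n})"
  by (auto simp: wheel_graph_def join_def complete_graph_def cycle_graph_def)

lemma edges_wheel: "edges (wheel_graph n) = spoke ` {..<n} \<union> rim n ` {..<n}"
proof -
  have "edges (complete_graph 1) = {}"
  proof -
    have "card e \<noteq> 2" if "e \<subseteq> {..<1::nat}" for e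
      using card_mono[OF _ that] by simp
    then show ?thesis
      by (auto simp: complete_graph_def)
  qed
  moreover have "{{Inl u, Inr v} |u v. u \<in> verts (complete_graph 1) \<and> v \<in> verts (cycle_graph n)} = spoke ` {..<n}"
    by (auto simp: complete_graph_def cycle_graph_def spoke_def)
  moreover have "(`) Inr ` edges (cycle_graph n) = rim n ` {..<n}"
  proof -
    have "edges (cycle_graph n) = (\<lambda>i. {i, Suc i mod n}) ` {..<n}"
      by (auto simp: cycle_graph_def)
    then show ?thesis
      by (simp add: image_image rim_def[abs_def])
  qed
  ultimately show ?thesis
    unfolding wheel_graph_def join_def by (simp add: Un_commute)
qed

lemma finite_edges_wheel: "finite (edges (wheel_graph n))"
  by (simp add: edges_wheel)

lemma spoke_in: "i < n \<Longrightarrow> spoke i \<in> edges (wheel_graph n)"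
  and rim_in: "i < n \<Longrightarrow> rim n i \<in> edges (wheel_graph n)"
  by (auto simp: edges_wheel)

lemma spoke_eq_iff [simp]: "spoke i = spoke j \<longleftrightarrow> i = j"
  by (auto simp: spoke_def doubleton_eq_iff)

lemma spoke_neq_rim [simp]: "spoke i \<noteq> rim n j" "rim n j \<noteq> spoke i"
  by (auto simp: spoke_def rim_def doubleton_eq_iff)

lemma rim_eq_iff:
  assumes "3 \<le> n" "i < n" "j < n"
  shows "rim n i = rim n j \<longleftrightarrow> i = j"
  using cyclic_edge_eq_iff[OF assms] by (auto simp: rim_def doubleton_eq_iff)

lemma Suc_mod_neq: "3 \<le> n \<Longrightarrow> i < n \<Longrightarrow> Suc i mod n \<noteq> i"
  by (auto simp: Suc_mod_eq)

lemma signature_cases: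
  assumes "\<sigma> \<in> signatures (wheel_graph n)" "e \<in> edges (wheel_graph n)"
  shows "\<sigma> e = 1 \<or> \<sigma> e = -1"
  using PiE_mem[OF assms[unfolded signatures_def]] by simp

lemma triangle_sign_cases:
  assumes "\<sigma> \<in> signatures (wheel_graph n)" "i < n"
  shows "triangle_sign n \<sigma> i = 1 \<or> triangle_sign n \<sigma> i = -1"
proof -
  have "Suc i mod n < n"
    using assms(2) by simp
  with assms have "\<sigma> (spoke i) = 1 \<or> \<sigma> (spoke i) = -1"
    "\<sigma> (spoke (Suc i mod n)) = 1 \<or> \<sigma> (spoke (Suc i mod n)) = -1"
    "\<sigma> (rim n i) = 1 \<or> \<sigma> (rim n i) = -1"
    by (meson signature_cases spoke_in rim_in)+
  then show ?thesis
    unfolding triangle_sign_def by auto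
qed

text \<open>Spoke signs square to 1, so the definition of \<open>triangle_sign\<close> can be solved
  for the rim edge. Spoke signs and triangle signs together thus determine the signature.\<close>

lemma rim_eq_triangle_sign:
  assumes "\<sigma> \<in> signatures (wheel_graph n)" "i < n"
  shows "\<sigma> (rim n i) = \<sigma> (spoke i) * \<sigma> (spoke (Suc i mod n)) * triangle_sign n \<sigma> i"
proof -
  have "Suc i mod n < n"
    using assms(2) by simp
  with assms have "\<sigma> (spoke i) = 1 \<or> \<sigma> (spoke i) = -1"
    "\<sigma> (spoke (Suc i mod n)) = 1 \<or> \<sigma> (spoke (Suc i mod n)) = -1"
    by (meson signature_cases spoke_in)+
  then show ?thesis
    unfolding triangle_sign_def by auto
qed

section \<open>Switching classes of the wheel\<close>

lemma card_doubleton_Int_eq_1: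
  assumes "a \<noteq> b"
  shows "card ({a, b} \<inter> X) = 1 \<longleftrightarrow> (a \<in> X) \<noteq> (b \<in> X)"
  using assms by (cases "a \<in> X"; cases "b \<in> X") (auto simp: Int_insert_left)

lemma switch_spoke:
  assumes "i < n"
  shows "switch (wheel_graph n) X \<sigma> (spoke i) =
    (if (Inl 0 \<in> X) \<noteq> (Inr i \<in> X) then - \<sigma> (spoke i) else \<sigma> (spoke i))"
  using spoke_in[OF assms] card_doubleton_Int_eq_1[of "Inl 0" "Inr i" X]
  by (auto simp: switch_def spoke_def)

lemma switch_rim:
  assumes "3 \<le> n" "i < n"
  shows "switch (wheel_graph n) X \<sigma> (rim n i) =
    (if (Inr i \<in> X) \<noteq> (Inr (Suc i mod n) \<in> X) then - \<sigma> (rim n i) else \<sigma> (rim n i))"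
  using rim_in[OF assms(2)] Suc_mod_neq[OF assms]
    card_doubleton_Int_eq_1[of "Inr i" "Inr (Suc i mod n)" X]
  by (auto simp: switch_def rim_def)

text \<open>Any vertex set separates the ends of either none or two of the edges of a triangle, so
  the sign changes cancel.\<close>

lemma triangle_sign_switch:
  assumes "3 \<le> n" "i < n"
  shows "triangle_sign n (switch (wheel_graph n) X \<sigma>) i = triangle_sign n \<sigma> i"
proof -
  have "Suc i mod n < n"
    using assms by simp
  then show ?thesis
    unfolding triangle_sign_def by (simp add: switch_spoke switch_rim assms)
qed

lemma switching_rel_wheel_iff:
  assumes n: "3 \<le> n"
    and \<sigma>: "\<sigma> \<in> signatures (wheel_graph n)" and \<tau>: "\<tau> \<in> signatures (wheel_graph n)"
  shows "(\<sigma>, \<tau>) \<in> switching_rel (wheel_graph n) \<longleftrightarrow>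
    positive_triangles n \<sigma> = positive_triangles n \<tau>"
proof
  assume "(\<sigma>, \<tau>) \<in> switching_rel (wheel_graph n)"
  then show "positive_triangles n \<sigma> = positive_triangles n \<tau>"
    using n by (auto simp: switching_rel_def positive_triangles_def triangle_sign_switch)
next
  assume eq: "positive_triangles n \<sigma> = positive_triangles n \<tau>"
  have tri: "triangle_sign n \<sigma> i = triangle_sign n \<tau> i" if "i < n" for i
  proof -
    have "i \<in> positive_triangles n \<sigma> \<longleftrightarrow> i \<in> positive_triangles n \<tau>"
      using eq by simp
    then have "triangle_sign n \<sigma> i = 1 \<longleftrightarrow> triangle_sign n \<tau> i = 1"
      using that by (simp add: positive_triangles_def)
    then show ?thesis
      using triangle_sign_cases[OF \<sigma> that] triangle_sign_cases[OF \<tau> that] by metis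
  qed
  \<comment> \<open>Leaving the hub outside \<open>X\<close>, switching corrects exactly the spokes
    on which the signatures differ. The rim edges then agree because the triangle signs do.\<close>
  define X where "X = (Inr ` {i. i < n \<and> \<sigma> (spoke i) \<noteq> \<tau> (spoke i)} :: (nat + nat) set)"
  have X_Inr: "Inr i \<in> X \<longleftrightarrow> \<sigma> (spoke i) \<noteq> \<tau> (spoke i)" if "i < n" for i
    using that by (auto simp: X_def)
  have X_Inl: "Inl 0 \<notin> X"
    by (auto simp: X_def)
  have sp: "switch (wheel_graph n) X \<sigma> (spoke i) = \<tau> (spoke i)" if i: "i < n" for i
    using signature_cases[OF \<sigma> spoke_in[OF i]] signature_cases[OF \<tau> spoke_in[OF i]]
    by (auto simp: switch_spoke i X_Inr X_Inl)
  have rm: "switch (wheel_graph n) X \<sigma> (rim n i) = \<tau> (rim n i)" if i: "i < n" for i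
  proof -
    have j: "Suc i mod n < n"
      using i by simp
    show ?thesis
      unfolding switch_rim[OF n i] X_Inr[OF i] X_Inr[OF j]
        rim_eq_triangle_sign[OF \<sigma> i] rim_eq_triangle_sign[OF \<tau> i] tri[OF i]
      using signature_cases[OF \<sigma> spoke_in[OF i]] signature_cases[OF \<tau> spoke_in[OF i]]
        signature_cases[OF \<sigma> spoke_in[OF j]] signature_cases[OF \<tau> spoke_in[OF j]]
      by (elim disjE; simp)
  qed
  have "\<tau> = switch (wheel_graph n) X \<sigma>"
  proof
    fix e
    show "\<tau> e = switch (wheel_graph n) X \<sigma> e"
    proof (cases "e \<in> edges (wheel_graph n)")
      case True
      then show ?thesis
        using sp rm by (auto simp: edges_wheel)
    next
      case False
      then show ?thesis
        using \<tau> by (auto simp: signatures_def switch_def PiE_def extensional_def)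
    qed
  qed
  moreover have "X \<subseteq> verts (wheel_graph n)"
    by (auto simp: X_def verts_wheel)
  ultimately show "(\<sigma>, \<tau>) \<in> switching_rel (wheel_graph n)"
    using \<sigma> \<tau> by (auto simp: switching_rel_def)
qed

lemma positive_triangles_surj:
  assumes n: "3 \<le> n" and Z: "Z \<subseteq> {..<n}"
  obtains \<sigma> where "\<sigma> \<in> signatures (wheel_graph n)" "positive_triangles n \<sigma> = Z"
proof
  \<comment> \<open>All spokes are positive, so each triangle has the sign of its rim edge.\<close>
  let ?s = "\<lambda>e\<in>edges (wheel_graph n). if e \<in> rim n ` ({..<n} - Z) then -1 else (1::int)"
  show "?s \<in> signatures (wheel_graph n)"
    by (auto simp: signatures_def)
  have sp: "?s (spoke i) = 1" if "i < n" for i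
    using that spoke_in[OF that] by auto
  have rm: "?s (rim n i) = (if i \<in> Z then 1 else -1)" if i: "i < n" for i
  proof -
    have "rim n i \<in> rim n ` ({..<n} - Z) \<longleftrightarrow> i \<notin> Z"
      using i rim_eq_iff[OF n i] by auto
    then show ?thesis
      using rim_in[OF i] by simp
  qed
  have "triangle_sign n ?s i = (if i \<in> Z then 1 else -1)" if i: "i < n" for i
  proof -
    have "Suc i mod n < n"
      using i by simp
    then show ?thesis
      unfolding triangle_sign_def sp[OF i] rm[OF i] by (subst sp) auto
  qed
  then show "positive_triangles n ?s = Z"
    using Z by (auto simp: positive_triangles_def split: if_splits)
qed

text \<open>A complete invariant \<open>f\<close> identifies the classes with its nonempty fibres,
  so counting classes becomes counting values of \<open>f\<close>.\<close>

lemma card_filtered_quotient: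
  assumes equiv: "equiv S R"
    and R: "\<And>x y. x \<in> S \<Longrightarrow> y \<in> S \<Longrightarrow> (x, y) \<in> R \<longleftrightarrow> f x = f y"
  shows "card {C \<in> S // R. \<forall>x\<in>C. P (f x)} = card {z \<in> f ` S. P z}"
proof -
  let ?cl = "\<lambda>z. {x \<in> S. f x = z}"
  have cl: "R `` {x} = ?cl (f x)" if "x \<in> S" for x
    using that R equiv_type[OF equiv] by auto
  have "{C \<in> S // R. \<forall>x\<in>C. P (f x)} = ?cl ` {z \<in> f ` S. P z}"
  proof (intro equalityI subsetI)
    fix C assume "C \<in> {C \<in> S // R. \<forall>x\<in>C. P (f x)}"
    then obtain x where "x \<in> S" "C = ?cl (f x)" "\<forall>x\<in>C. P (f x)"
      using cl by (auto elim!: quotientE)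
    then show "C \<in> ?cl ` {z \<in> f ` S. P z}"
      by auto
  next
    fix C assume "C \<in> ?cl ` {z \<in> f ` S. P z}"
    then obtain x where x: "x \<in> S" "P (f x)" "C = ?cl (f x)"
      by auto
    then have "C \<in> S // R"
      using quotientI[of x S R] cl by simp
    then show "C \<in> {C \<in> S // R. \<forall>x\<in>C. P (f x)}"
      using x by auto
  qed
  moreover have "inj_on ?cl {z \<in> f ` S. P z}"
    by (rule inj_onI) blast
  ultimately show ?thesis
    by (simp add: card_image)
qed

section \<open>Bounds on the frustration index\<close>

lemma frustration_index_wheel_le_card:
  assumes n: "3 \<le> n" and \<sigma>: "\<sigma> \<in> signatures (wheel_graph n)"
    and A: "A \<subseteq> {..<n}"
    and indep: "\<And>i. i \<in> A \<Longrightarrow> Suc i mod n \<notin> A"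
    and cover: "\<And>i. i < n \<Longrightarrow> i \<notin> positive_triangles n \<sigma> \<Longrightarrow> i \<in> A \<or> Suc i mod n \<in> A"
  shows "frustration_index (wheel_graph n) \<sigma> \<le> card A"
proof -
  let ?G = "wheel_graph n"
  let ?t = "triangle_sign n \<sigma>"
  \<comment> \<open>The predecessor of \<open>i\<close> on the rim; adding \<open>n\<close> first
    avoids truncated subtraction at 0. Vertex \<open>i\<close> lies on the triangles
    \<open>p i\<close> and \<open>i\<close>.\<close>
  define p where "p i = (i + n - 1) mod n" for i
  have p_less: "p i < n" for i
    using n by (simp add: p_def)
  have p_Suc: "p (Suc i mod n) = i" if "i < n" for i
    using that by (auto simp: p_def Suc_mod_eq)
  \<comment> \<open>If one of the two triangles at \<open>i\<close> is positive, deleting the rim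
    edge of the other suffices. If both are negative, the spoke goes, and switching \<open>i\<close>
    repairs both rim edges.\<close>
  define f where
    "f i = (if ?t i = 1 then rim n (p i) else if ?t (p i) = 1 then rim n i else spoke i)" for i
  let ?F = "f ` A"
  have F: "?F \<subseteq> edges ?G"
  proof
    fix e assume "e \<in> ?F"
    then obtain i where "i \<in> A" "e = f i"
      by auto
    then show "e \<in> edges ?G"
      using A p_less[of i] rim_in[of "p i" n] rim_in[of i n] spoke_in[of i n]
      by (auto simp: f_def)
  qed
  \<comment> \<open>\<open>x\<close> switches the vertices of \<open>A\<close> between two negative triangles; on top of making
    all spokes positive, this makes every surviving edge positive.\<close>
  define x where "x i = (if i \<in> A \<and> ?t i \<noteq> 1 \<and> ?t (p i) \<noteq> 1 then -1 else (1::int))" for i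
  \<comment> \<open>The potential for \<open>balancedI\<close>. The value 1 beyond the rim only
    keeps \<open>s v * s v = 1\<close> true for every \<open>v\<close>.\<close>
  define s where "s v = (case v of Inl _ \<Rightarrow> 1 | Inr i \<Rightarrow> if i < n then \<sigma> (spoke i) * x i else 1)"
    for v :: "nat + nat"
  have s_sq: "s v * s v = 1" for v
  proof (cases v)
    case (Inr i)
    then show ?thesis
      using signature_cases[OF \<sigma> spoke_in[of i n]] by (auto simp: s_def x_def)
  qed (simp add: s_def)
  have sp: "\<sigma> (spoke i) = s (Inl 0) * s (Inr i)" if "i < n" "spoke i \<notin> ?F" for i
  proof -
    have "x i = 1"
      using that(2) by (auto simp: x_def f_def)
    then show ?thesis
      using that by (simp add: s_def)
  qed
  have rm: "\<sigma> (rim n i) = s (Inr i) * s (Inr (Suc i mod n))" if i: "i < n" and nF: "rim n i \<notin> ?F" for i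
  proof -
    let ?j = "Suc i mod n"
    have j: "?j < n"
      using i by simp
    \<comment> \<open>The spoke signs in \<open>s\<close> already account for the remaining factors
      of \<open>rim_eq_triangle_sign\<close>.\<close>
    have "?t i = x i * x ?j"
    proof (cases "?t i = 1")
      case True
      then have "x i = 1" "x ?j = 1"
        using p_Suc[OF i] by (auto simp: x_def)
      with True show ?thesis
        by simp
    next
      case False
      then have ti: "?t i = -1"
        using triangle_sign_cases[OF \<sigma> i] by blast
      from False have "i \<in> A \<or> ?j \<in> A"
        using cover[OF i] by (auto simp: positive_triangles_def)
      then show ?thesis
      proof
        assume iA: "i \<in> A"
        then have "?j \<notin> A"
          by (rule indep)
        \<comment> \<open>Otherwise \<open>f i\<close> would be \<open>rim n i\<close>, which is not
          deleted.\<close>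
        moreover have "?t (p i) \<noteq> 1"
          using nF iA False by (auto simp: f_def image_iff)
        ultimately show ?thesis
          using iA ti by (simp add: x_def)
      next
        assume jA: "?j \<in> A"
        then have "i \<notin> A"
          using indep by blast
        moreover have "?t ?j \<noteq> 1"
        proof
          assume "?t ?j = 1"
          then have "f ?j = rim n i"
            using p_Suc[OF i] by (simp add: f_def)
          then show False
            using nF jA by (metis imageI)
        qed
        ultimately show ?thesis
          using jA ti p_Suc[OF i] by (simp add: x_def)
      qed
    qed
    then show ?thesis
      using rim_eq_triangle_sign[OF \<sigma> i] i j by (simp add: s_def)
  qed
  have "balanced (delete_edges ?G ?F) (restrict \<sigma> (edges ?G - ?F))"
  proof (rule balancedI[where s = s])
    fix u v :: "nat + nat" assume "{u, v} \<in> edges (delete_edges ?G ?F)"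
    then have uv: "{u, v} \<in> edges ?G - ?F"
      by (simp add: delete_edges_def)
    then consider i where "i < n" "{u, v} = spoke i" | i where "i < n" "{u, v} = rim n i"
      by (auto simp: edges_wheel)
    then have "\<sigma> {u, v} = s u * s v"
    proof cases
      case (1 i)
      then have "\<sigma> {u, v} = s (Inl 0) * s (Inr i)"
        using sp uv by simp
      moreover have "u = Inl 0 \<and> v = Inr i \<or> u = Inr i \<and> v = Inl 0"
        using 1(2) by (simp add: spoke_def doubleton_eq_iff)
      ultimately show ?thesis
        by (metis mult.commute)
    next
      case (2 i)
      then have "\<sigma> {u, v} = s (Inr i) * s (Inr (Suc i mod n))"
        using rm uv by simp
      moreover have "u = Inr i \<and> v = Inr (Suc i mod n) \<or> u = Inr (Suc i mod n) \<and> v = Inr i"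
        using 2(2) by (simp add: rim_def doubleton_eq_iff)
      ultimately show ?thesis
        by (metis mult.commute)
    qed
    then show "restrict \<sigma> (edges ?G - ?F) {u, v} = s u * s v"
      using uv by simp
  qed (rule s_sq)
  then have "frustration_index ?G \<sigma> \<le> card ?F"
    by (rule frustration_index_le[OF finite_edges_wheel F])
  also have "\<dots> \<le> card A"
    by (rule card_image_le) (use A finite_subset in blast)
  finally show ?thesis .
qed

text \<open>\<open>A\<close>, the set of predecessors of \<open>A\<close>, and \<open>Z\<close> are
  pairwise disjoint in \<open>{..<n}\<close>, and the cyclic shift gives the first two equal
  size.\<close>

lemma card_independent_le:
  assumes A: "A \<subseteq> {..<n}" and indep: "\<And>i. i \<in> A \<Longrightarrow> Suc i mod n \<notin> A"
    and Z: "Z \<subseteq> {..<n}" and free: "\<And>i. i \<in> Z \<Longrightarrow> i \<notin> A \<and> Suc i mod n \<notin> A"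
  shows "2 * card A + card Z \<le> n"
proof -
  let ?g = "\<lambda>i. Suc i mod n"
  let ?B = "{i \<in> {..<n}. ?g i \<in> A}"
  have fin: "finite A" "finite Z"
    using A Z finite_subset by blast+
  have "?g ` ?B = A"
  proof -
    have "A \<subseteq> ?g ` {..<n}"
      using A bij_betw_Suc_mod[of n] by (simp add: bij_betw_def)
    then show ?thesis
      by auto
  qed
  moreover have "inj_on ?g ?B"
    using bij_betw_Suc_mod[of n] by (auto simp: bij_betw_def intro: inj_on_subset)
  ultimately have B: "card ?B = card A"
    by (metis (no_types, lifting) card_image)
  have "card ?B + card A + card Z = card (?B \<union> A \<union> Z)"
    using fin indep free by (subst card_Un_disjoint; (subst card_Un_disjoint)?; auto)
  also have "\<dots> \<le> card {..<n}"
    using A Z by (intro card_mono) auto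
  finally show ?thesis
    using B by simp
qed

text \<open>Since \<open>n\<close> is even, the even rim vertices are independent and meet every rim
  edge.\<close>

lemma frustration_index_wheel_le:
  assumes n: "3 \<le> n" "even n" and \<sigma>: "\<sigma> \<in> signatures (wheel_graph n)"
  shows "frustration_index (wheel_graph n) \<sigma> \<le> n div 2"
proof -
  let ?A = "{i. i < n \<and> even i}"
  have parity: "even (Suc i mod n) \<longleftrightarrow> odd i" if "i < n" for i
    using that n by (auto simp: Suc_mod_eq)
  have "frustration_index (wheel_graph n) \<sigma> \<le> card ?A"
    by (rule frustration_index_wheel_le_card[OF n(1) \<sigma>]) (use parity n in auto)
  moreover have "2 * card ?A + card ({} :: nat set) \<le> n"
    by (rule card_independent_le) (use parity in auto)
  ultimately show ?thesis
    by simp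
qed

lemma frustration_index_wheel_less:
  assumes n: "3 \<le> n" "even n" and \<sigma>: "\<sigma> \<in> signatures (wheel_graph n)"
    and a: "a \<in> positive_triangles n \<sigma>" "even a" and b: "b \<in> positive_triangles n \<sigma>" "odd b"
  shows "frustration_index (wheel_graph n) \<sigma> < n div 2"
proof -
  define p q where "p = min a b" and "q = max a b"
  have pq: "p < q" "q < n" "even p \<noteq> even q" "p \<in> positive_triangles n \<sigma>" "q \<in> positive_triangles n \<sigma>"
    using a b by (auto simp: p_def q_def min_def max_def positive_triangles_def less_le)
  \<comment> \<open>Without the rim edges \<open>p\<close> and \<open>q\<close> the rim splits into
    two paths, on the vertices from \<open>p + 1\<close> to \<open>q\<close> and, cyclically, from
    \<open>q + 1\<close> to \<open>p\<close>. Both have an even number of edges; \<open>A\<close>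
    takes every second vertex, starting with the second, and so covers both paths while avoiding
    their ends.\<close>
  define A where "A = {i. i < n \<and> (if p < i \<and> i < q then even i = even p
    else i \<noteq> p \<and> i \<noteq> q \<and> even i = even q)}"
  have A: "A \<subseteq> {..<n}"
    by (auto simp: A_def)
  have step: "i \<in> A \<or> Suc i mod n \<in> A" if i: "i < n" "i \<noteq> p" "i \<noteq> q" for i
  proof (cases "Suc i = n")
    case True
    \<comment> \<open>The edge from \<open>n - 1\<close> to 0: if \<open>q\<close> is odd,
      \<open>n - 1\<close> is in \<open>A\<close>; if \<open>q\<close> is even, \<open>p\<close> is
      odd, hence nonzero, and 0 is in \<open>A\<close>.\<close>
    then have "q < i" "odd i"
      using i pq n(2) by auto
    then show ?thesis
      using i pq True by (auto simp: A_def intro: gr0I)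
  next
    case False
    then have "Suc i mod n = Suc i" "Suc i < n"
      using i by auto
    moreover have "Suc i \<noteq> p \<or> even i = even q \<and> \<not> p < i"
      "Suc i \<noteq> q \<or> even i = even p \<and> p < i \<and> i < q"
      "p < Suc i \<longleftrightarrow> p < i" "Suc i < q \<longleftrightarrow> i < q \<and> Suc i \<noteq> q"
      using i pq by auto
    ultimately show ?thesis
      using i pq(1-3) unfolding A_def mem_Collect_eq
      by (simp only: even_Suc if_bool_eq_conj) satx
  qed
  have indep: "Suc i mod n \<notin> A" if "i \<in> A" for i
    using that pq n(2) by (cases "Suc i = n") (auto simp: A_def Suc_mod_eq split: if_splits)
  have free: "i \<notin> A \<and> Suc i mod n \<notin> A" if "i \<in> {p, q}" for i
    using that pq n(2) by (cases "Suc i = n") (auto simp: A_def Suc_mod_eq split: if_splits)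
  have "frustration_index (wheel_graph n) \<sigma> \<le> card A"
    by (rule frustration_index_wheel_le_card[OF n(1) \<sigma> A indep]) (use step pq in metis)+
  moreover have "2 * card A + card {p, q} \<le> n"
    by (rule card_independent_le[OF A indep _ free]) (use pq in auto)
  ultimately show ?thesis
    using pq by simp
qed

lemma card_parity_class:
  assumes "even n"
  shows "card {i. i < n \<and> even i = b} = n div 2"
proof -
  obtain m where m: "n = 2 * m"
    using assms by blast
  have "{i. i < n \<and> even i = b} = (\<lambda>k. 2 * k + (if b then 0 else 1)) ` {..<m}"
    by (auto simp: m image_iff elim!: evenE oddE; presburger)
  then show ?thesis
    by (simp add: card_image inj_on_def m)
qed

text \<open>By \<open>Z\<close> all triangles of parity \<open>b\<close> are negative, so a
  balancing deletion meets each of them. Their edge-disjointness makes a choice \<open>g\<close> of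
  deleted edges injective.\<close>

lemma frustration_index_wheel_ge:
  assumes n: "3 \<le> n" "even n" and \<sigma>: "\<sigma> \<in> signatures (wheel_graph n)"
    and Z: "\<And>i. i \<in> positive_triangles n \<sigma> \<Longrightarrow> even i \<noteq> b"
  shows "n div 2 \<le> frustration_index (wheel_graph n) \<sigma>"
proof (rule frustration_index_ge[OF finite_edges_wheel])
  let ?G = "wheel_graph n"
  let ?I = "{i. i < n \<and> even i = b}"
  let ?T = "\<lambda>i. {spoke i, rim n i, spoke (Suc i mod n)}"
  fix F assume F: "F \<subseteq> edges ?G" and bal: "balanced (delete_edges ?G F) (restrict \<sigma> (edges ?G - F))"
  have hit: "\<exists>e. e \<in> F \<and> e \<in> ?T i" if i: "i \<in> ?I" for i
  proof (rule ccontr)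
    assume none: "\<not> ?thesis"
    let ?j = "Suc i mod n"
    let ?vs = "[Inl 0, Inr i, Inr ?j]"
    have ij: "i < n" "?j < n" "?j \<noteq> i"
      using i n Suc_mod_neq by auto
    have ce: "cycle_edges ?vs = ?T i"
      unfolding cycle_edges_triangle spoke_def rim_def by (rule refl)
    have sub: "?T i \<subseteq> edges ?G - F"
      using none ij spoke_in rim_in by auto
    have "is_cycle (delete_edges ?G F) ?vs"
      unfolding is_cycle_def ce using sub ij by (auto simp: delete_edges_def verts_wheel)
    then have "cycle_sign (restrict \<sigma> (edges ?G - F)) ?vs = 1"
      using bal by (simp add: balanced_def)
    then have "triangle_sign n \<sigma> i = 1"
      using sub ij unfolding cycle_sign_def ce by (simp add: triangle_sign_def mult_ac)
    then show False
      using Z[of i] i by (auto simp: positive_triangles_def)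
  qed
  then obtain g where g: "\<And>i. i \<in> ?I \<Longrightarrow> g i \<in> F \<and> g i \<in> ?T i"
    by metis
  have "inj_on g ?I"
  proof (rule inj_onI)
    fix i j assume i: "i \<in> ?I" and j: "j \<in> ?I" and eq: "g i = g j"
    \<comment> \<open>Distinct triangles share an edge only if they are cyclically adjacent; equal
      parity excludes this, also across the wrap because \<open>n\<close> is even.\<close>
    have ne: "Suc i mod n \<noteq> j" "Suc j mod n \<noteq> i"
      using i j n by (auto simp: Suc_mod_eq intro: gr0I)
    show "i = j"
    proof (rule ccontr)
      assume "i \<noteq> j"
      then have "Suc i mod n \<noteq> Suc j mod n" "rim n i \<noteq> rim n j"
        using i j rim_eq_iff[OF n(1)] by (auto simp: Suc_mod_eq)
      then have "?T i \<inter> ?T j = {}"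
        using ne \<open>i \<noteq> j\<close> by simp
      moreover have "g i \<in> ?T i" "g i \<in> ?T j"
        using g[OF i] g[OF j] unfolding eq by blast+
      ultimately show False
        by blast
    qed
  qed
  moreover have "g ` ?I \<subseteq> F"
    using g by blast
  moreover have "finite F"
    using F finite_edges_wheel finite_subset by blast
  ultimately show "n div 2 \<le> card F"
    using card_inj_on_le[of g ?I F] card_parity_class[OF n(2)] by simp
qed

section \<open>Maximising signatures and their number\<close>

lemma frustration_index_wheel_eq_iff:
  assumes "3 \<le> n" "even n" "\<sigma> \<in> signatures (wheel_graph n)"
  shows "frustration_index (wheel_graph n) \<sigma> = n div 2 \<longleftrightarrow>
    (\<exists>b. \<forall>i\<in>positive_triangles n \<sigma>. even i = b)"
proof
  assume "frustration_index (wheel_graph n) \<sigma> = n div 2"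
  then show "\<exists>b. \<forall>i\<in>positive_triangles n \<sigma>. even i = b"
    using frustration_index_wheel_less[OF assms] by (metis less_irrefl)
next
  assume "\<exists>b. \<forall>i\<in>positive_triangles n \<sigma>. even i = b"
  \<comment> \<open>The lower bound uses the parity class free of positive triangles, hence the
    negation.\<close>
  then obtain b where "\<And>i. i \<in> positive_triangles n \<sigma> \<Longrightarrow> even i \<noteq> (\<not> b)"
    by auto
  then show "frustration_index (wheel_graph n) \<sigma> = n div 2"
    using frustration_index_wheel_ge[OF assms] frustration_index_wheel_le[OF assms]
    by (meson le_antisym)
qed

lemma max_frustration_index_wheel:
  assumes "3 \<le> n" "even n"
  shows "max_frustration_index (wheel_graph n) = n div 2"
  unfolding max_frustration_index_def
proof (rule Max_eqI)
  show "finite {frustration_index (wheel_graph n) \<sigma> |\<sigma>. \<sigma> \<in> signatures (wheel_graph n)}"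
    by (rule finite_subset[of _ "{..n div 2}"]) (use frustration_index_wheel_le assms in auto)
  show "y \<le> n div 2"
    if "y \<in> {frustration_index (wheel_graph n) \<sigma> |\<sigma>. \<sigma> \<in> signatures (wheel_graph n)}" for y
    using that frustration_index_wheel_le assms by auto
  \<comment> \<open>With every triangle negative, the parity condition holds vacuously and the bound
    is attained.\<close>
  obtain \<sigma> where "\<sigma> \<in> signatures (wheel_graph n)" "positive_triangles n \<sigma> = {}"
    using positive_triangles_surj[OF assms(1), of "{}"] by auto
  then show "n div 2 \<in> {frustration_index (wheel_graph n) \<sigma> |\<sigma>. \<sigma> \<in> signatures (wheel_graph n)}"
    using frustration_index_wheel_eq_iff[OF assms] by force
qed

lemma card_single_parity_subsets:
  assumes "even n"
  shows "card {Z \<in> Pow {..<n}. \<exists>b. \<forall>i\<in>Z. even i = b} = 2 ^ (n div 2 + 1) - 1"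
proof -
  let ?P = "\<lambda>b. {i. i < n \<and> even i = b}"
  have "{Z \<in> Pow {..<n}. \<exists>b. \<forall>i\<in>Z. even i = b} = Pow (?P True) \<union> Pow (?P False)"
    by (auto; metis)
  moreover have "Pow (?P True) \<inter> Pow (?P False) = {{}}"
    by fastforce
  moreover have "card (Pow (?P b)) = 2 ^ (n div 2)" for b
    using card_parity_class[OF assms] by (simp add: card_Pow)
  note this[of True] this[of False]
  \<comment> \<open>Inclusion-exclusion in additive form: the 1 accounts for the empty set, common
    to both power sets.\<close>
  ultimately have "card {Z \<in> Pow {..<n}. \<exists>b. \<forall>i\<in>Z. even i = b} + 1 = 2 ^ (n div 2) + 2 ^ (n div 2)"
    using card_Un_Int[of "Pow (?P True)" "Pow (?P False)"] by simp
  then show ?thesis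
    by simp
qed

theorem corollary26:
  fixes n :: nat
  assumes "4 \<le> n" and "even n"
  shows "card {C \<in> switching_classes (wheel_graph n).
           \<forall>\<sigma>\<in>C. frustration_index (wheel_graph n) \<sigma> = max_frustration_index (wheel_graph n)}
         = 2 ^ (n div 2 + 1) - 1"
proof -
  let ?G = "wheel_graph n"
  let ?S = "signatures ?G" and ?R = "switching_rel ?G"
  let ?Q = "\<lambda>Z. \<exists>b. \<forall>i\<in>Z. even i = b"
  have n: "3 \<le> n" "even n"
    using assms by auto
  have equiv: "equiv ?S ?R"
    by (rule equiv_switching_rel[OF simple_graph_wheel_graph[OF n(1)]])
  \<comment> \<open>Members of a class are signatures, so the extremal condition can be replaced by
    one on the invariant \<open>positive_triangles n\<close>.\<close>
  have "(\<forall>\<sigma>\<in>C. frustration_index ?G \<sigma> = max_frustration_index ?G)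
      \<longleftrightarrow> (\<forall>\<sigma>\<in>C. ?Q (positive_triangles n \<sigma>))" if "C \<in> ?S // ?R" for C
    using in_quotient_imp_subset[OF equiv that]
    unfolding max_frustration_index_wheel[OF n]
    by (intro ball_cong refl frustration_index_wheel_eq_iff[OF n]) auto
  then have "{C \<in> switching_classes ?G. \<forall>\<sigma>\<in>C. frustration_index ?G \<sigma> = max_frustration_index ?G}
      = {C \<in> ?S // ?R. \<forall>\<sigma>\<in>C. ?Q (positive_triangles n \<sigma>)}"
    unfolding switching_classes_def by blast
  also have "card \<dots> = card {Z \<in> positive_triangles n ` ?S. ?Q Z}"
    by (rule card_filtered_quotient[OF equiv switching_rel_wheel_iff[OF n(1)]])
  also have "positive_triangles n ` ?S = Pow {..<n}"
  proof
    show "positive_triangles n ` ?S \<subseteq> Pow {..<n}"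
      by (auto simp: positive_triangles_def)
    show "Pow {..<n} \<subseteq> positive_triangles n ` ?S"
      using positive_triangles_surj[OF n(1)] by (metis PowD image_eqI subsetI)
  qed
  also have "card {Z \<in> Pow {..<n}. ?Q Z} = 2 ^ (n div 2 + 1) - 1"
    by (rule card_single_parity_subsets[OF n(2)])
  finally show ?thesis .
qed

end
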